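(* Let $(\Omega,\mu)$ be a $\sigma$-finite measure space (with $\mu$ a positive measure) with infinite measure, $\mu(\Omega)=\infty$, and let $\mathcal{H}$ be a finite dimensional complex Hilbert space. Then there exists a continuous frame $F:\Omega\to\mathcal{H}$ with respect to $(\Omega,\mu)$.
   Context: Let $\mathcal{H}$ be a complex Hilbert space and $(\Omega,\mu)$ a measure space with positive measure $\mu$. A mapping $F:\Omega\to\mathcal{H}$ is a continuous frame with respect to $(\Omega,\mu)$ if (1) $F$ is weakly measurable, i.e. for every $f\in\mathcal{H}$ the function $\omega\mapsto\langle f,F(\omega)\rangle$ is measurable on $\Omega$; and (2) there exist constants $A,B>0$ such that $A\|f\|^2\le\int_\Omega|\langle f,F(\omega)\rangle|^2\,d\mu(\omega)\le B\|f\|^2$ for all $f\in\mathcal{H}$. *)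

theory Defs
  imports "HOL-Analysis.Analysis"
begin

text \<open>
  A complex inner product space, with the inner product linear in its first argument.  The real
  scalar multiplication and the norm inherited from \<^class>\<open>real_normed_vector\<close> are those
  induced by the complex structure.
\<close>

class complex_inner = real_normed_vector +
  fixes scaleC :: "complex \<Rightarrow> 'a \<Rightarrow> 'a"
    and cinner :: "'a \<Rightarrow> 'a \<Rightarrow> complex"
  assumes scaleC_add_right: "scaleC a (x + y) = scaleC a x + scaleC a y"
    and scaleC_add_left: "scaleC (a + b) x = scaleC a x + scaleC b x"
    and scaleC_scaleC: "scaleC a (scaleC b x) = scaleC (a * b) x"
    and scaleC_one: "scaleC 1 x = x"
    and scaleR_scaleC: "scaleR r x = scaleC (complex_of_real r) x"
    and cinner_commute: "cinner x y = cnj (cinner y x)"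
    and cinner_add_left: "cinner (x + y) z = cinner x z + cinner y z"
    and cinner_scaleC_left: "cinner (scaleC a x) y = a * cinner x y"
    and cinner_ge_zero: "0 \<le> Re (cinner x x)"
    and cinner_eq_zero_iff: "cinner x x = 0 \<longleftrightarrow> x = 0"
    and norm_eq_sqrt_cinner: "norm x = sqrt (Re (cinner x x))"

class complex_hilbert_space = complex_inner + complete_space

definition finite_dimensional :: "'h::complex_inner itself \<Rightarrow> bool" where
  "finite_dimensional _ \<longleftrightarrow>
     (\<exists>Basis. finite_dimensional_vector_space (scaleC :: complex \<Rightarrow> 'h \<Rightarrow> 'h) Basis)"

definition weakly_measurable :: "'w measure \<Rightarrow> ('w \<Rightarrow> 'h::complex_inner) \<Rightarrow> bool" where
  "weakly_measurable M F \<longleftrightarrow> (\<forall>f. (\<lambda>\<omega>. cinner f (F \<omega>)) \<in> borel_measurable M)"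

text \<open>
  The integral is the extended nonnegative Lebesgue integral, so the upper bound includes its
  finiteness.
\<close>

definition continuous_frame :: "'w measure \<Rightarrow> ('w \<Rightarrow> 'h::complex_hilbert_space) \<Rightarrow> bool" where
  "continuous_frame M F \<longleftrightarrow>
     weakly_measurable M F \<and>
     (\<exists>A B :: real. A > 0 \<and> B > 0 \<and>
        (\<forall>f. ennreal (A * (norm f)\<^sup>2)
               \<le> (\<integral>\<^sup>+ \<omega>. ennreal ((cmod (cinner f (F \<omega>)))\<^sup>2) \<partial>M) \<and>
             (\<integral>\<^sup>+ \<omega>. ennreal ((cmod (cinner f (F \<omega>)))\<^sup>2) \<partial>M)
               \<le> ennreal (B * (norm f)\<^sup>2)))"

end

theory Submission imports Defs
begin

text \<open>
  A \<open>\<sigma>\<close>-finite space of infinite measure cannot be covered by finitely many sets of finite measure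
  together with countably many null sets.  Hence it contains infinitely many disjoint sets of
  positive finite measure, enough to assign one set \<open>E b\<close> to each vector \<open>b\<close> of an orthonormal
  basis.  Let \<open>F\<close> take the constant value \<open>b / sqrt (\<mu> (E b))\<close> on \<open>E b\<close> and vanish elsewhere.  Each
  point lies in at most one \<open>E b\<close>, so no cross terms appear in \<open>|\<langle>f, F \<omega>\<rangle>|\<^sup>2\<close>, and its integral is
  the sum of the \<open>|\<langle>f, b\<rangle>|\<^sup>2\<close>.  By Parseval's identity this is \<open>\<parallel>f\<parallel>\<^sup>2\<close>, so both frame bounds can be
  taken to be 1.
\<close>

section \<open>Inner products and orthonormal bases\<close>

lemma cinner_zero_left: "cinner 0 (y::'h::complex_inner) = 0"
  using cinner_add_left[of 0 0 y] by simp

lemma cinner_zero_right: "cinner (x::'h::complex_inner) 0 = 0"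
  by (subst cinner_commute) (simp add: cinner_zero_left)

lemma cinner_add_right: "cinner x (y + z) = cinner x y + cinner (x::'h::complex_inner) z"
  by (metis cinner_add_left cinner_commute complex_cnj_add)

lemma cinner_diff_left: "cinner (x - y) z = cinner x z - cinner (y::'h::complex_inner) z"
  using cinner_add_left[of "x - y" y z] by simp

lemma cinner_scaleR_right: "cinner x (r *\<^sub>R y) = of_real r * cinner x (y::'h::complex_inner)"
  by (metis cinner_commute cinner_scaleC_left complex_cnj_complex_of_real complex_cnj_mult
      scaleR_scaleC)

lemma cinner_scaleR_left: "cinner (r *\<^sub>R x) y = of_real r * cinner x (y::'h::complex_inner)"
  by (simp add: scaleR_scaleC cinner_scaleC_left)

lemma cinner_sum_left: "cinner (sum g S) (y::'h::complex_inner) = (\<Sum>s\<in>S. cinner (g s) y)"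
  by (induction S rule: infinite_finite_induct) (auto simp: cinner_zero_left cinner_add_left)

lemma cinner_sum_right: "cinner (x::'h::complex_inner) (sum g S) = (\<Sum>s\<in>S. cinner x (g s))"
  by (induction S rule: infinite_finite_induct) (auto simp: cinner_zero_right cinner_add_right)

text \<open>Conjugate symmetry makes \<open>\<langle>x, x\<rangle>\<close> real, so its real part is all of it.\<close>

lemma cinner_self: "cinner x x = of_real ((norm (x::'h::complex_inner))\<^sup>2)"
proof -
  have "Im (cinner x x) = 0"
    using cinner_commute[of x x] by (simp add: complex_eq_iff)
  then show ?thesis
    by (simp add: complex_eq_iff norm_eq_sqrt_cinner cinner_ge_zero)
qed

definition orthonormal :: "'h::complex_inner set \<Rightarrow> bool" where
  "orthonormal B \<longleftrightarrow> (\<forall>x\<in>B. \<forall>y\<in>B. cinner x y = (if x = y then 1 else 0))"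

lemma cinner_orthonormal_combination:
  assumes "orthonormal B" "finite B" "b \<in> B"
  shows "cinner (\<Sum>x\<in>B. scaleC (c x) x) b = c b"
proof -
  have "cinner (\<Sum>x\<in>B. scaleC (c x) x) b = (\<Sum>x\<in>B. if x = b then c b else 0)"
    unfolding cinner_sum_left
    using assms by (intro sum.cong) (auto simp: orthonormal_def cinner_scaleC_left)
  also have "\<dots> = c b"
    using assms by simp
  finally show ?thesis .
qed

text \<open>
  Pairing a linear relation among orthonormal vectors with one of them isolates its coefficient, so
  orthonormal sets are linearly independent and the dimension bounds their size.
\<close>

lemma orthonormal_card_bounded:
  assumes "finite_dimensional TYPE('h::complex_inner)"
  obtains n where "\<And>B :: 'h set. orthonormal B \<Longrightarrow> finite B \<Longrightarrow> card B \<le> n"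
proof -
  obtain Bas where "finite_dimensional_vector_space (scaleC :: complex \<Rightarrow> 'h \<Rightarrow> 'h) Bas"
    using assms by (auto simp: finite_dimensional_def)
  then interpret V: finite_dimensional_vector_space "scaleC :: complex \<Rightarrow> 'h \<Rightarrow> 'h" Bas .
  have "card B \<le> V.dim UNIV" if B: "orthonormal B" "finite B" for B :: "'h set"
  proof (rule V.independent_card_le_dim[OF subset_UNIV], rule V.independent_if_scalars_zero)
    fix c :: "'h \<Rightarrow> complex" and x
    assume "(\<Sum>x\<in>B. scaleC (c x) x) = 0" "x \<in> B"
    then show "c x = 0"
      using cinner_orthonormal_combination[OF B, of x c] by (simp add: cinner_zero_left)
  qed (fact B(2))
  then show ?thesis using that by blast
qed

text \<open>
  An orthonormal set of the largest possible cardinality is a basis: if some \<open>f\<close> differed from its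
  orthogonal projection, the normalised difference could be added to the set.
\<close>

lemma orthonormal_basis_exists:
  assumes "finite_dimensional TYPE('h::complex_inner)"
  obtains B :: "'h::complex_inner set" where "finite B" "orthonormal B"
    "\<And>f. f = (\<Sum>b\<in>B. scaleC (cinner f b) b)"
proof -
  obtain n where n: "\<And>B :: 'h set. orthonormal B \<Longrightarrow> finite B \<Longrightarrow> card B \<le> n"
    using orthonormal_card_bounded[OF assms] by blast
  have "orthonormal ({}::'h set) \<and> finite ({}::'h set)"
    by (simp add: orthonormal_def)
  then obtain B :: "'h set" where B: "orthonormal B" "finite B"
    and max: "\<And>C :: 'h set. orthonormal C \<Longrightarrow> finite C \<Longrightarrow> card C \<le> card B"
    using ex_has_greatest_nat[of "\<lambda>B::'h set. orthonormal B \<and> finite B" "{}" card "Suc n"] n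
    by (auto simp: less_Suc_eq_le)
  have "f = (\<Sum>b\<in>B. scaleC (cinner f b) b)" for f
  proof (rule ccontr)
    define g where "g = f - (\<Sum>b\<in>B. scaleC (cinner f b) b)"
    define e where "e = (1 / norm g) *\<^sub>R g"
    assume "f \<noteq> (\<Sum>b\<in>B. scaleC (cinner f b) b)"
    then have "norm g \<noteq> 0"
      by (simp add: g_def)
    then have e1: "cinner e e = 1"
      unfolding cinner_self by (simp add: e_def)
    have "cinner g b = 0" if "b \<in> B" for b
      using cinner_orthonormal_combination[OF B that] by (simp add: g_def cinner_diff_left)
    then have eb: "cinner e b = 0" if "b \<in> B" for b
      using that by (simp add: e_def cinner_scaleR_left)
    then have be: "cinner b e = 0" if "b \<in> B" for b
      using that cinner_commute[of b e] by simp
    have "e \<notin> B"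
      using eb e1 by force
    moreover have "orthonormal (insert e B)"
      using B(1) e1 eb be \<open>e \<notin> B\<close> by (auto simp: orthonormal_def)
    ultimately show False
      using max[of "insert e B"] B(2) by simp
  qed
  then show ?thesis
    using that B by blast
qed

text \<open>The identity comes from pairing the expansion of \<open>f\<close> with \<open>f\<close> itself.\<close>

lemma parseval:
  fixes f :: "'h::complex_inner"
  assumes "f = (\<Sum>b\<in>B. scaleC (cinner f b) b)"
  shows "(norm f)\<^sup>2 = (\<Sum>b\<in>B. (cmod (cinner f b))\<^sup>2)"
proof -
  have "complex_of_real ((norm f)\<^sup>2) = cinner (\<Sum>b\<in>B. scaleC (cinner f b) b) f"
    using assms cinner_self[of f] by simp
  also have "\<dots> = (\<Sum>b\<in>B. cinner f b * cnj (cinner f b))"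
    unfolding cinner_sum_left cinner_scaleC_left by (subst (2) cinner_commute) simp
  also have "\<dots> = complex_of_real (\<Sum>b\<in>B. (cmod (cinner f b))\<^sup>2)"
    by (simp only: complex_norm_square[symmetric] of_real_sum)
  finally show ?thesis
    by (simp only: of_real_eq_iff)
qed

section \<open>Disjoint sets of positive finite measure\<close>

text \<open>
  If only finitely many pieces of a disjoint countable decomposition into sets of finite measure had
  positive measure, the whole space would have finite measure.  Enumerating the non-null pieces
  gives the family.
\<close>

lemma (in sigma_finite_measure) disjoint_sets_of_positive_finite_measure:
  assumes "emeasure M (space M) = \<infinity>"
  obtains E :: "nat \<Rightarrow> 'a set" where "\<And>i. E i \<in> sets M" "disjoint_family E"
    "\<And>i. 0 < emeasure M (E i)" "\<And>i. emeasure M (E i) < \<infinity>"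
proof -
  obtain A :: "nat \<Rightarrow> 'a set" where A: "range A \<subseteq> sets M" "(\<Union>i. A i) = space M"
    "\<And>i. emeasure M (A i) \<noteq> \<infinity>" "disjoint_family A"
    using sigma_finite_disjoint by blast
  define K where "K = {i. emeasure M (A i) \<noteq> 0}"
  have "infinite K"
  proof
    assume "finite K"
    have "emeasure M (space M) = (\<Sum>i. emeasure M (A i))"
      using suminf_emeasure[OF A(1,4)] A(2) by simp
    also have "\<dots> = (\<Sum>i\<in>K. emeasure M (A i))"
      using \<open>finite K\<close> by (intro suminf_finite) (auto simp: K_def)
    also have "\<dots> \<noteq> \<infinity>"
      using \<open>finite K\<close> A(3) by simp
    finally show False
      using assms by simp
  qed
  let ?E = "\<lambda>i. A (enumerate K i)"
  have K: "enumerate K i \<in> K" for i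
    using \<open>infinite K\<close> by (rule enumerate_in_set)
  show ?thesis
  proof (rule that[of ?E])
    show "disjoint_family ?E"
      using A(4) inj_enumerate[OF \<open>infinite K\<close>] unfolding disjoint_family_on_def inj_def by blast
    show "0 < emeasure M (?E i)" for i
      using K[of i] by (simp add: K_def zero_less_iff_neq_zero)
    show "emeasure M (?E i) < \<infinity>" for i
      using A(3) by (simp add: less_top)
  qed (use A(1) in auto)
qed

section \<open>The frame\<close>

text \<open>
  At most one summand is nonzero, which is why the square of the modulus is additive here.
\<close>

lemma norm_sum_indicator_disjoint:
  fixes z :: "'i \<Rightarrow> complex"
  assumes "finite B" "disjoint_family_on E B"
  shows "(cmod (\<Sum>b\<in>B. of_real (indicator (E b) w) * z b))\<^sup>2
    = (\<Sum>b\<in>B. (cmod (z b))\<^sup>2 * indicator (E b) w)"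
proof (cases "\<exists>b\<in>B. w \<in> E b")
  case True
  then obtain a where a: "a \<in> B" "w \<in> E a"
    by blast
  then have ind: "indicator (E b) w = (if b = a then 1 else 0 :: real)" if "b \<in> B" for b
    using assms(2) that by (auto simp: disjoint_family_on_def indicator_def)
  have "(\<Sum>b\<in>B. of_real (indicator (E b) w) * z b) = (\<Sum>b\<in>B. if b = a then z a else 0)"
    by (rule sum.cong) (simp_all add: ind)
  moreover have "(\<Sum>b\<in>B. (cmod (z b))\<^sup>2 * indicator (E b) w)
      = (\<Sum>b\<in>B. if b = a then (cmod (z a))\<^sup>2 else 0)"
    by (rule sum.cong) (simp_all add: ind)
  ultimately show ?thesis
    using a(1) assms(1) by simp
next
  case False
  then show ?thesis by simp
qed

theorem proposition3p4:
  fixes M :: "'w measure"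
  assumes "sigma_finite_measure M"
    and "emeasure M (space M) = \<infinity>"
    and "finite_dimensional TYPE('h::complex_hilbert_space)"
  shows "\<exists>F :: 'w \<Rightarrow> 'h. continuous_frame M F"
proof -
  obtain B :: "'h set" where B: "finite B"
    and expansion: "\<And>f. f = (\<Sum>b\<in>B. scaleC (cinner f b) b)"
    using orthonormal_basis_exists[OF assms(3)] by blast
  obtain E' :: "nat \<Rightarrow> 'w set" where E': "\<And>i. E' i \<in> sets M" "disjoint_family E'"
    "\<And>i. 0 < emeasure M (E' i)" "\<And>i. emeasure M (E' i) < \<infinity>"
    using sigma_finite_measure.disjoint_sets_of_positive_finite_measure[OF assms(1,2)] by blast
  obtain idx :: "'h \<Rightarrow> nat" where idx: "inj_on idx B"
    using finite_imp_inj_to_nat_seg[OF B] by blast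
  define E where "E b = E' (idx b)" for b
  have E_sets [measurable]: "E b \<in> sets M" for b
    by (simp add: E_def E'(1))
  have disj: "disjoint_family_on E B"
    using E'(2) idx unfolding disjoint_family_on_def inj_on_def E_def by blast
  define m where "m b = measure M (E b)" for b
  have emeasure_E: "emeasure M (E b) = ennreal (m b)" for b
    using E'(4)[of "idx b"] by (simp add: m_def E_def emeasure_eq_ennreal_measure less_top)
  have m_pos: "m b > 0" for b
    using E'(3)[of "idx b"] emeasure_E[of b] by (simp add: E_def)
  define F :: "'w \<Rightarrow> 'h" where
    "F w = (\<Sum>b\<in>B. (indicator (E b) w / sqrt (m b)) *\<^sub>R b)" for w
  have cinner_F: "cinner f (F w) = (\<Sum>b\<in>B. of_real (indicator (E b) w) * (cinner f b / sqrt (m b)))"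
    for f w
    by (simp add: F_def cinner_sum_right cinner_scaleR_right)
  have "weakly_measurable M F"
    unfolding weakly_measurable_def cinner_F by measurable
  moreover have "(\<integral>\<^sup>+ w. ennreal ((cmod (cinner f (F w)))\<^sup>2) \<partial>M) = ennreal ((norm f)\<^sup>2)" for f
  proof -
    let ?c = "\<lambda>b. (cmod (cinner f b))\<^sup>2"
    have "ennreal ((cmod (cinner f (F w)))\<^sup>2) = (\<Sum>b\<in>B. ennreal (?c b / m b) * indicator (E b) w)"
      for w
    proof -
      have "(cmod (cinner f (F w)))\<^sup>2 = (\<Sum>b\<in>B. ?c b / m b * indicator (E b) w)"
        unfolding cinner_F norm_sum_indicator_disjoint[OF B disj]
        using m_pos by (simp add: norm_divide power_divide less_imp_le)
      also have "ennreal \<dots> = (\<Sum>b\<in>B. ennreal (?c b / m b * indicator (E b) w))"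
        using m_pos by (intro sum_ennreal[symmetric]) (simp add: less_imp_le)
      also have "\<dots> = (\<Sum>b\<in>B. ennreal (?c b / m b) * indicator (E b) w)"
        by (intro sum.cong refl) (simp add: indicator_def)
      finally show ?thesis .
    qed
    then have "(\<integral>\<^sup>+ w. ennreal ((cmod (cinner f (F w)))\<^sup>2) \<partial>M)
        = (\<Sum>b\<in>B. ennreal (?c b / m b) * emeasure M (E b))"
      by (simp add: nn_integral_sum nn_integral_cmult_indicator)
    also have "\<dots> = (\<Sum>b\<in>B. ennreal (?c b))"
      using m_pos by (intro sum.cong refl)
        (simp add: emeasure_E ennreal_mult'[symmetric] less_imp_le less_imp_neq[symmetric])
    also have "\<dots> = ennreal ((norm f)\<^sup>2)"
      by (simp add: parseval[OF expansion])
    finally show ?thesis .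
  qed
  ultimately have "continuous_frame M F"
    unfolding continuous_frame_def by (intro conjI exI[of _ 1]) auto
  then show ?thesis
    by blast
qed

end
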